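(* Let $X$ be a discrete log-concave random variable. Then $$\mathbb{P}(X < \mathbb{E}[X] + 1) \geq e^{-1}.$$
   Context: An integer-valued random variable $X$ with probability mass function $p(k)=\mathbb{P}(X=k)$, $k\in\mathbb{Z}$, is called (discrete) log-concave if $p(k)^2 \geq p(k-1)\,p(k+1)$ for all $k\in\mathbb{Z}$ and $X$ has contiguous support, meaning that $\{k\in\mathbb{Z} : p(k)>0\}$ is a set of consecutive integers (finite or infinite in either direction). *)

theory Defs
  imports "HOL-Probability.Probability"
begin

text \<open>A set of consecutive integers, possibly empty or unbounded in either direction.\<close>

definition consecutive_integers :: "int set \<Rightarrow> bool" where
  "consecutive_integers S \<longleftrightarrow> (\<forall>i\<in>S. \<forall>k\<in>S. {i..k} \<subseteq> S)"

definition prob_mass :: "'a measure \<Rightarrow> ('a \<Rightarrow> int) \<Rightarrow> int \<Rightarrow> real" where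
  "prob_mass M X k = \<P>(\<omega> in M. X \<omega> = k)"

definition discrete_log_concave :: "'a measure \<Rightarrow> ('a \<Rightarrow> int) \<Rightarrow> bool" where
  "discrete_log_concave M X \<longleftrightarrow>
     (\<forall>k. (prob_mass M X k)\<^sup>2 \<ge> prob_mass M X (k - 1) * prob_mass M X (k + 1)) \<and>
     consecutive_integers {k. prob_mass M X k > 0}"

end

theory Submission
  imports Defs
begin

text \<open>
  Write \<open>F k = P(X \<le> k)\<close>.  The argument is Jensen's inequality for the concave function
  \<open>ln F\<close>.  Since \<open>F X\<close> is stochastically at least uniform on the unit interval,
  \<open>E (ln (F X))\<close> is at least the integral of \<open>ln\<close> over \<open>(0, 1)\<close>, which is \<open>- 1\<close>.  If \<open>ln F\<close> is
  concave, it lies below a line of slope \<open>a \<ge> 0\<close> touching it at \<open>m = \<lceil>E X\<rceil>\<close>, and taking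
  expectations gives \<open>- 1 \<le> ln (F m) + a * (E X - m) \<le> ln (F m)\<close>.  The integers
  below \<open>E X + 1\<close> are exactly those that are at most \<open>m\<close>, so this is the claim.

  Summation preserves log-concavity: \<open>F\<close> inherits it from the mass function because a
  log-concave sequence has decreasing ratios (lemmas \<open>log_concave_ratio_decreasing\<close> and
  \<open>cdf_log_concave\<close>).  The estimate of the expectation of the line is lemma
  \<open>expectation_ge_of_exponential_cdf_bound\<close>; there the integral of \<open>ln\<close> is replaced by the
  telescoping increments of its primitive \<open>u * ln u - u\<close>.

  Finally, the expectation has to exist.  A strict increase of the log-concave function \<open>F\<close>
  somewhere forces geometric decay at minus infinity, and the same holds for the
  reflected variable \<open>- X\<close>; so both tails are integrable.
\<close>

section \<open>Log-concave functions on the integers\<close>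

text \<open>
  Contiguity of the support is what allows the local inequality to be propagated:
  the induction step cancels the factor \<open>f j\<close>, which is positive unless one of the
  two outer values vanishes.
\<close>

lemma log_concave_ratio_decreasing:
  fixes f :: "int \<Rightarrow> real"
  assumes nonneg: "\<And>k. f k \<ge> 0"
    and lc: "\<And>k. f (k - 1) * f (k + 1) \<le> (f k)\<^sup>2"
    and supp: "consecutive_integers {k. f k > 0}"
    and "j \<le> k"
  shows "f j * f (k + 1) \<le> f (j + 1) * f k"
  using \<open>j \<le> k\<close>
proof (induction j rule: int_le_induct)
  case base
  show ?case by (simp add: mult.commute)
next
  case (step j)
  show ?case
  proof (cases "f (j - 1) > 0 \<and> f (k + 1) > 0")
    case True
    with supp have "{j - 1..k + 1} \<subseteq> {k. f k > 0}"
      unfolding consecutive_integers_def by blast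
    moreover have "j \<in> {j - 1..k + 1}" using step.hyps by simp
    ultimately have pos: "f j > 0" by blast
    have "f (j - 1) * f (k + 1) * f j \<le> f (j - 1) * (f (j + 1) * f k)"
      using mult_left_mono[OF step.IH nonneg[of "j - 1"]] by (simp add: mult_ac)
    also have "\<dots> \<le> (f j)\<^sup>2 * f k"
      using mult_right_mono[OF lc[of j] nonneg[of k]] by (simp add: mult_ac)
    finally have "(f (j - 1) * f (k + 1)) * f j \<le> (f j * f k) * f j"
      by (simp add: power2_eq_square mult_ac)
    with pos show ?thesis by (simp add: mult.commute)
  next
    case False
    then have "f (j - 1) * f (k + 1) = 0"
      using nonneg[of "j - 1"] nonneg[of "k + 1"] by (auto simp: not_less)
    then show ?thesis
      using mult_nonneg_nonneg[OF nonneg[of j] nonneg[of k]] by (simp only: diff_add_cancel)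
  qed
qed

text \<open>
  This is the supporting line of the concave function \<open>ln f\<close> at \<open>m\<close>, in exponential form.
  The slope is the increment of \<open>ln f\<close> to the right of \<open>m\<close>, so that \<open>f\<close> may vanish to the
  left of \<open>m\<close>.
\<close>

lemma log_concave_le_exponential:
  fixes f :: "int \<Rightarrow> real"
  assumes nonneg: "\<And>k. f k \<ge> 0"
    and lc: "\<And>k. f (k - 1) * f (k + 1) \<le> (f k)\<^sup>2"
    and supp: "consecutive_integers {k. f k > 0}"
    and pos: "f m > 0" "f (m + 1) > 0"
  shows "f k \<le> f m * exp (ln (f (m + 1) / f m) * (real_of_int k - real_of_int m))"
proof -
  note ratio = log_concave_ratio_decreasing[of f, OF nonneg lc supp]
  define r where "r = f (m + 1) / f m"
  define g where "g k = f m * exp (ln r * (real_of_int k - real_of_int m))" for k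
  have r: "r > 0" using pos by (simp add: r_def)
  have g_Suc: "g (k + 1) = r * g k" for k
  proof -
    have "ln r * (real_of_int (k + 1) - real_of_int m) =
        ln r + ln r * (real_of_int k - real_of_int m)"
      by (simp add: algebra_simps)
    then show ?thesis using r by (simp add: g_def exp_add)
  qed
  have g_pred: "g k = r * g (k - 1)" for k
    using g_Suc[of "k - 1"] by simp
  have "f k \<le> g k"
  proof (induction k rule: int_induct[where k = m])
    case base
    show ?case by (simp add: g_def)
  next
    case (step1 k)
    have "f (k + 1) \<le> r * f k"
      using ratio[OF step1.hyps] pos by (simp add: r_def field_simps)
    also have "\<dots> \<le> r * g k" using step1.IH r by simp
    finally show ?case by (simp add: g_Suc)
  next
    case (step2 k)
    have "r * f (k - 1) \<le> f k"
      using ratio[of "k - 1" m] step2.hyps pos by (simp add: r_def field_simps)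
    also have "\<dots> \<le> r * g (k - 1)" using step2.IH g_pred[of k] by simp
    finally show ?case using r by simp
  qed
  then show ?thesis by (simp add: g_def r_def)
qed

section \<open>Distribution functions of integer-valued random variables\<close>

context prob_space
begin

lemma prob_le_eq_prob_less_plus_prob_mass:
  fixes X :: "'a \<Rightarrow> int"
  assumes [measurable]: "X \<in> measurable M (count_space UNIV)"
  shows "\<P>(\<omega> in M. X \<omega> \<le> k) = \<P>(\<omega> in M. X \<omega> \<le> k - 1) + prob_mass M X k"
proof -
  have "{\<omega> \<in> space M. X \<omega> \<le> k} =
      {\<omega> \<in> space M. X \<omega> \<le> k - 1} \<union> {\<omega> \<in> space M. X \<omega> = k}"
    by auto
  then show ?thesis
    unfolding prob_mass_def by (subst finite_measure_Union[symmetric]) auto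
qed

lemma prob_mass_sums_prob_le:
  fixes X :: "'a \<Rightarrow> int"
  assumes [measurable]: "X \<in> measurable M (count_space UNIV)"
  shows "(\<lambda>n. prob_mass M X (k - int n)) sums \<P>(\<omega> in M. X \<omega> \<le> k)"
proof -
  have eq: "{\<omega> \<in> space M. X \<omega> \<le> k} = (\<Union>n. {\<omega> \<in> space M. X \<omega> = k - int n})"
  proof safe
    fix \<omega> assume "\<omega> \<in> space M" "X \<omega> \<le> k"
    then show "\<omega> \<in> (\<Union>n. {\<omega> \<in> space M. X \<omega> = k - int n})"
      by (auto intro!: exI[of _ "nat (k - X \<omega>)"])
  qed auto
  show ?thesis
    unfolding prob_mass_def eq
    by (rule finite_measure_UNION) (auto simp: disjoint_family_on_def)
qed

lemma prob_le_mono: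
  fixes X :: "'a \<Rightarrow> int"
  assumes [measurable]: "X \<in> measurable M (count_space UNIV)" and "j \<le> k"
  shows "\<P>(\<omega> in M. X \<omega> \<le> j) \<le> \<P>(\<omega> in M. X \<omega> \<le> k)"
  using \<open>j \<le> k\<close> by (intro finite_measure_mono) auto

lemma prob_le_tendsto_1:
  fixes X :: "'a \<Rightarrow> int"
  assumes [measurable]: "X \<in> measurable M (count_space UNIV)"
  shows "(\<lambda>n. \<P>(\<omega> in M. X \<omega> \<le> int n)) \<longlonglongrightarrow> 1"
proof -
  have eq: "(\<Union>n. {\<omega> \<in> space M. X \<omega> \<le> int n}) = space M"
  proof safe
    fix \<omega> assume "\<omega> \<in> space M"
    then show "\<omega> \<in> (\<Union>n. {\<omega> \<in> space M. X \<omega> \<le> int n})"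
      by (auto intro!: exI[of _ "nat (X \<omega>)"])
  qed
  have "(\<lambda>n. \<P>(\<omega> in M. X \<omega> \<le> int n)) \<longlonglongrightarrow> prob (\<Union>n. {\<omega> \<in> space M. X \<omega> \<le> int n})"
    by (rule finite_Lim_measure_incseq) (auto simp: incseq_def)
  then show ?thesis unfolding eq by (simp add: prob_space)
qed

lemma prob_le_tendsto_0:
  fixes X :: "'a \<Rightarrow> int"
  assumes [measurable]: "X \<in> measurable M (count_space UNIV)"
  shows "(\<lambda>n. \<P>(\<omega> in M. X \<omega> \<le> - int n)) \<longlonglongrightarrow> 0"
proof -
  have eq: "(\<Inter>n. {\<omega> \<in> space M. X \<omega> \<le> - int n}) = {}"
  proof safe
    fix \<omega> assume "\<omega> \<in> (\<Inter>n. {\<omega> \<in> space M. X \<omega> \<le> - int n})"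
    then have "X \<omega> \<le> - int (nat (1 - X \<omega>))" by blast
    then show "\<omega> \<in> {}" by linarith
  qed
  have "(\<lambda>n. \<P>(\<omega> in M. X \<omega> \<le> - int n)) \<longlonglongrightarrow> prob (\<Inter>n. {\<omega> \<in> space M. X \<omega> \<le> - int n})"
    by (rule finite_Lim_measure_decseq) (auto simp: decseq_def)
  then show ?thesis unfolding eq by simp
qed

lemma discrete_log_concave_ratio:
  assumes "discrete_log_concave M X" and "j \<le> k"
  shows "prob_mass M X j * prob_mass M X (k + 1) \<le> prob_mass M X (j + 1) * prob_mass M X k"
  using assms unfolding discrete_log_concave_def
  by (intro log_concave_ratio_decreasing) (auto simp: prob_mass_def)

text \<open>
  With \<open>p\<close> the mass function, the claim is equivalent to
  \<open>p (k + 1) * F (k - 1) \<le> p k * F k\<close>.  Expanding both distribution functions into series, with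
  the second one shifted by one place, reduces this to decreasing ratios of \<open>p\<close> term by term.
\<close>

lemma cdf_log_concave:
  fixes X :: "'a \<Rightarrow> int"
  assumes X: "X \<in> measurable M (count_space UNIV)" and lc: "discrete_log_concave M X"
  shows "\<P>(\<omega> in M. X \<omega> \<le> k - 1) * \<P>(\<omega> in M. X \<omega> \<le> k + 1) \<le> (\<P>(\<omega> in M. X \<omega> \<le> k))\<^sup>2"
proof -
  define F where "F k = \<P>(\<omega> in M. X \<omega> \<le> k)" for k
  define p where "p = prob_mass M X"
  have F_eq: "F k = F (k - 1) + p k" for k
    using prob_le_eq_prob_less_plus_prob_mass[OF X] by (simp add: F_def p_def)
  have sums: "(\<lambda>n. p (k - int n)) sums F k" for k
    using prob_mass_sums_prob_le[OF X] by (simp add: F_def p_def)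
  have "p (k + 1) * F (k - 1) \<le> p k * F k"
  proof (rule sums_le[OF _ sums_mult[OF sums] sums_mult[OF sums]])
    fix n
    show "p (k + 1) * p (k - 1 - int n) \<le> p k * p (k - int n)"
      using discrete_log_concave_ratio[OF lc, of "k - 1 - int n" k]
      by (simp add: p_def mult.commute)
  qed
  then have "F (k - 1) * (F k + p (k + 1)) \<le> F k * (F (k - 1) + p k)"
    by (simp add: algebra_simps)
  then have "F (k - 1) * F (k + 1) \<le> (F k)\<^sup>2"
    using F_eq[of k] F_eq[of "k + 1"] by (simp add: power2_eq_square)
  then show ?thesis by (simp add: F_def)
qed

lemma consecutive_integers_cdf_support:
  fixes X :: "'a \<Rightarrow> int"
  assumes "X \<in> measurable M (count_space UNIV)"
  shows "consecutive_integers {k. \<P>(\<omega> in M. X \<omega> \<le> k) > 0}"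
  unfolding consecutive_integers_def
  using prob_le_mono[OF assms] by (fastforce intro: less_le_trans)

lemma cdf_le_exponential:
  fixes X :: "'a \<Rightarrow> int"
  assumes X: "X \<in> measurable M (count_space UNIV)" and lc: "discrete_log_concave M X"
    and pos: "\<P>(\<omega> in M. X \<omega> \<le> m) > 0"
  shows "\<P>(\<omega> in M. X \<omega> \<le> k) \<le> \<P>(\<omega> in M. X \<omega> \<le> m) *
    exp (ln (\<P>(\<omega> in M. X \<omega> \<le> m + 1) / \<P>(\<omega> in M. X \<omega> \<le> m)) *
      (real_of_int k - real_of_int m))"
proof -
  have "\<P>(\<omega> in M. X \<omega> \<le> m + 1) > 0"
    using pos prob_le_mono[OF X, of m "m + 1"] by simp
  then show ?thesis
    using pos cdf_log_concave[OF X lc] consecutive_integers_cdf_support[OF X]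
    by (intro log_concave_le_exponential[where f = "\<lambda>k. \<P>(\<omega> in M. X \<omega> \<le> k)"]) auto
qed

section \<open>Integrability\<close>

text \<open>
  If \<open>F\<close> vanishes somewhere, \<open>q = 0\<close> works, because \<open>0 ^ 0 = 1\<close>.  Otherwise \<open>F\<close> is positive and,
  tending to zero, has a strict increment at some \<open>m\<close>; the ratio \<open>q\<close> there bounds all
  ratios further to the left.
\<close>

lemma cdf_geometric_decay:
  fixes X :: "'a \<Rightarrow> int"
  assumes X: "X \<in> measurable M (count_space UNIV)" and lc: "discrete_log_concave M X"
  obtains m q where "0 \<le> q" "q < 1" "\<And>n. \<P>(\<omega> in M. X \<omega> \<le> m - int n) \<le> q ^ n"
proof -
  define F where "F k = \<P>(\<omega> in M. X \<omega> \<le> k)" for k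
  have mono: "F j \<le> F k" if "j \<le> k" for j k
    using prob_le_mono[OF X that] by (simp add: F_def)
  have F_nonneg: "F k \<ge> 0" and F_le_1: "F k \<le> 1" for k
    by (simp_all add: F_def)
  show thesis
  proof (cases "\<exists>k. F k = 0")
    case True
    then obtain k where k: "F k = 0" by blast
    have "F (k - int n) \<le> 0 ^ n" for n
      using mono[of "k - int n" k] k by (cases n) simp_all
    then show thesis using that[of 0 k] by (simp add: F_def)
  next
    case False
    then have pos: "F k > 0" for k
      using F_nonneg[of k] by (metis order.not_eq_order_implies_strict)
    have "\<exists>m. F m < F (m + 1)"
    proof (rule ccontr)
      assume no_increment: "\<not> ?thesis"
      have step: "F (m + 1) = F m" for m
      proof (rule antisym)
        show "F (m + 1) \<le> F m" using no_increment not_less by blast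
      qed (use mono in simp)
      have const: "F (- int n) = F 0" for n
      proof (induction n)
        case (Suc n)
        then show ?case using step[of "- int (Suc n)"] by simp
      qed simp
      have "(\<lambda>n. F (- int n)) \<longlonglongrightarrow> 0"
        using prob_le_tendsto_0[OF X] by (simp add: F_def)
      then have "F 0 = 0" unfolding const by (simp add: LIMSEQ_const_iff)
      with pos[of 0] show False by simp
    qed
    then obtain m where m: "F m < F (m + 1)" by blast
    define q where "q = F m / F (m + 1)"
    have q: "0 < q" "q < 1" using m pos by (simp_all add: q_def)
    have "F (m - int n) \<le> q ^ n" for n
    proof -
      have "F (m - int n) \<le> F m * exp (ln (F (m + 1) / F m) *
          (real_of_int (m - int n) - real_of_int m))"
        unfolding F_def using pos[of m] by (intro cdf_le_exponential X lc) (simp add: F_def)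
      also have "ln (F (m + 1) / F m) * (real_of_int (m - int n) - real_of_int m) = real n * ln q"
        using pos[of m] pos[of "m + 1"] by (simp add: q_def ln_div algebra_simps)
      also have "exp (real n * ln q) = q ^ n"
        using q by (simp add: exp_of_nat_mult)
      also have "F m * q ^ n \<le> 1 * q ^ n"
        using F_le_1[of m] q by (intro mult_right_mono) simp_all
      finally show ?thesis by simp
    qed
    then show thesis using that[of q m] q by (simp add: F_def)
  qed
qed

lemma integrable_lower_tail:
  fixes X :: "'a \<Rightarrow> int"
  assumes X [measurable]: "X \<in> measurable M (count_space UNIV)"
    and lc: "discrete_log_concave M X"
  obtains m where "integrable M (\<lambda>\<omega>. real (nat (m - X \<omega>)))"
proof -
  obtain m q where q: "0 \<le> q" "q < 1"
    and decay: "\<And>n. \<P>(\<omega> in M. X \<omega> \<le> m - int n) \<le> q ^ n"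
    using cdf_geometric_decay[OF X lc] by blast
  have "(\<integral>\<^sup>+\<omega>. of_nat (nat (m - X \<omega>)) \<partial>M)
      = (\<Sum>t. emeasure M {\<omega> \<in> space M. t < nat (m - X \<omega>)})"
    by (rule nn_integral_nat_function) measurable
  also have "\<dots> \<le> (\<Sum>t. ennreal (q ^ t))"
  proof (intro suminf_le)
    fix t
    have "prob {\<omega> \<in> space M. t < nat (m - X \<omega>)} \<le> \<P>(\<omega> in M. X \<omega> \<le> m - int t)"
      by (intro finite_measure_mono) auto
    also have "\<dots> \<le> q ^ t" by (rule decay)
    finally show "emeasure M {\<omega> \<in> space M. t < nat (m - X \<omega>)} \<le> ennreal (q ^ t)"
      by (simp add: emeasure_eq_measure ennreal_leI)
  qed simp_all
  also have "\<dots> = ennreal (\<Sum>t. q ^ t)"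
    using q by (intro suminf_ennreal2 summable_geometric) simp_all
  also have "\<dots> < \<infinity>" by simp
  finally have "(\<integral>\<^sup>+\<omega>. ennreal (real (nat (m - X \<omega>))) \<partial>M) < \<infinity>"
    by (simp add: ennreal_of_nat_eq_real_of_nat)
  then have "integrable M (\<lambda>\<omega>. real (nat (m - X \<omega>)))"
    by (intro integrableI_nonneg) simp_all
  then show thesis by (rule that)
qed

lemma discrete_log_concave_uminus:
  assumes "discrete_log_concave M X"
  shows "discrete_log_concave M (\<lambda>\<omega>. - X \<omega>)"
proof -
  have mass: "prob_mass M (\<lambda>\<omega>. - X \<omega>) k = prob_mass M X (- k)" for k
    unfolding prob_mass_def by (rule arg_cong[where f = prob]) auto
  have lc: "prob_mass M X (k - 1) * prob_mass M X (k + 1) \<le> (prob_mass M X k)\<^sup>2" for k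
    using assms by (simp add: discrete_log_concave_def)
  have supp: "prob_mass M X j > 0" if "prob_mass M X i > 0" "prob_mass M X k > 0" "i \<le> j" "j \<le> k"
    for i j k
  proof -
    have "{i..k} \<subseteq> {k. prob_mass M X k > 0}"
      using assms that(1,2) unfolding discrete_log_concave_def consecutive_integers_def by blast
    moreover have "j \<in> {i..k}" using that by simp
    ultimately show ?thesis by blast
  qed
  show ?thesis
    unfolding discrete_log_concave_def consecutive_integers_def mass
  proof (intro conjI allI ballI subsetI)
    fix k
    show "prob_mass M X (- (k - 1)) * prob_mass M X (- (k + 1)) \<le> (prob_mass M X (- k))\<^sup>2"
      using lc[of "- k"] by (simp add: mult.commute)
  next
    fix i k j
    assume "i \<in> {k. 0 < prob_mass M X (- k)}" "k \<in> {k. 0 < prob_mass M X (- k)}" "j \<in> {i..k}"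
    then show "j \<in> {k. 0 < prob_mass M X (- k)}"
      using supp[of "- k" "- i" "- j"] by simp
  qed
qed

lemma integrable_discrete_log_concave:
  fixes X :: "'a \<Rightarrow> int"
  assumes X [measurable]: "X \<in> measurable M (count_space UNIV)"
    and lc: "discrete_log_concave M X"
  shows "integrable M (\<lambda>\<omega>. real_of_int (X \<omega>))"
proof -
  obtain m where lower: "integrable M (\<lambda>\<omega>. real (nat (m - X \<omega>)))"
    using integrable_lower_tail[OF X lc] by blast
  have "(\<lambda>\<omega>. - X \<omega>) \<in> measurable M (count_space UNIV)" by measurable
  then obtain l where upper: "integrable M (\<lambda>\<omega>. real (nat (l - - X \<omega>)))"
    using integrable_lower_tail discrete_log_concave_uminus[OF lc] by blast
  have "integrable M (\<lambda>\<omega>. \<bar>real_of_int m\<bar> + \<bar>real_of_int l\<bar> +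
      real (nat (m - X \<omega>)) + real (nat (l - - X \<omega>)))"
    by (intro Bochner_Integration.integrable_add lower upper integrable_const)
  then show ?thesis
  proof (rule Bochner_Integration.integrable_bound)
    have "\<bar>real_of_int (X \<omega>)\<bar> \<le> \<bar>real_of_int m\<bar> + \<bar>real_of_int l\<bar> +
        real (nat (m - X \<omega>)) + real (nat (l - - X \<omega>))" for \<omega>
    proof -
      have nat_ge: "real_of_int z \<le> real (nat z)" for z by linarith
      show ?thesis
        using nat_ge[of "m - X \<omega>"] nat_ge[of "l - - X \<omega>"]
          of_nat_0_le_iff[of "nat (m - X \<omega>)", where 'a = real]
          of_nat_0_le_iff[of "nat (l - - X \<omega>)", where 'a = real]
          abs_ge_self[of "real_of_int m"] abs_ge_minus_self[of "real_of_int m"]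
          abs_ge_self[of "real_of_int l"] abs_ge_minus_self[of "real_of_int l"]
        unfolding of_int_diff of_int_minus by (intro abs_leI) linarith+
    qed
    then show "AE \<omega> in M. norm (real_of_int (X \<omega>)) \<le> norm (\<bar>real_of_int m\<bar> +
        \<bar>real_of_int l\<bar> + real (nat (m - X \<omega>)) + real (nat (l - - X \<omega>)))"
      by (intro AE_I2) (simp only: real_norm_def order_trans[OF _ abs_ge_self])
  qed simp
qed

section \<open>The expectation of a line above the logarithm of the distribution function\<close>

text \<open>
  A right-endpoint Riemann sum of the increasing function \<open>ln\<close>, with primitive
  \<open>\<lambda>u. u * ln u - u\<close>, is at least the integral.  The convention \<open>ln 0 = 0\<close> gives the primitive its
  limit value at \<open>0\<close>.
\<close>

lemma increment_ln_primitive_le: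
  fixes a b :: real
  assumes "0 \<le> a" "a \<le> b" "0 < b"
  shows "(b * ln b - b) - (a * ln a - a) \<le> (b - a) * ln b"
proof (cases "a = 0")
  case False
  with assms have a: "a > 0" by simp
  have "a * ln (b / a) \<le> a * (b / a - 1)"
    using a assms by (intro mult_left_mono ln_le_minus_one) simp_all
  then show ?thesis
    using a assms by (simp add: ln_div algebra_simps)
qed (use assms in simp)

text \<open>
  The bound says that \<open>a * X + c\<close> dominates \<open>ln U\<close> stochastically for \<open>U\<close> uniform on
  \<open>(0, 1)\<close>, and \<open>E (ln U) = - 1\<close>.  The comparison is carried out on the window
  \<open>- n < X \<le> n\<close>, where the increments of \<open>u * ln u - u\<close> telescope; the lower boundary term
  has the right sign, so only the upper one has to be followed to its limit.
\<close>

lemma expectation_ge_of_exponential_cdf_bound: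
  fixes X :: "'a \<Rightarrow> int" and a c :: real
  assumes X [measurable]: "X \<in> measurable M (count_space UNIV)"
    and int: "integrable M (\<lambda>\<omega>. real_of_int (X \<omega>))"
    and bound: "\<And>k. \<P>(\<omega> in M. X \<omega> \<le> k) \<le> exp (a * real_of_int k + c)"
  shows "a * (\<integral>\<omega>. real_of_int (X \<omega>) \<partial>M) + c \<ge> - 1"
proof -
  define F where "F k = \<P>(\<omega> in M. X \<omega> \<le> k)" for k
  define p where "p = prob_mass M X"
  define Z where "Z k = a * real_of_int k + c" for k
  define \<phi> where "\<phi> u = u * ln u - u" for u :: real
  have F_eq: "F k = F (k - 1) + p k" for k
    using prob_le_eq_prob_less_plus_prob_mass[OF X] by (simp add: F_def p_def)
  have p_nonneg: "p k \<ge> 0" for k by (simp add: p_def prob_mass_def)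
  have F_nonneg: "F k \<ge> 0" and F_le_1: "F k \<le> 1" for k by (simp_all add: F_def)
  have increment: "\<phi> (F k) - \<phi> (F (k - 1)) \<le> p k * Z k" for k
  proof (cases "F k = 0")
    case True
    then have "F (k - 1) = 0" "p k = 0"
      using F_eq[of k] F_nonneg[of "k - 1"] p_nonneg[of k] by simp_all
    with True show ?thesis by simp
  next
    case False
    then have pos: "F k > 0" using F_nonneg[of k] by simp
    have "\<phi> (F k) - \<phi> (F (k - 1)) \<le> (F k - F (k - 1)) * ln (F k)"
      unfolding \<phi>_def using pos F_nonneg[of "k - 1"] F_eq[of k] p_nonneg[of k]
      by (intro increment_ln_primitive_le) simp_all
    also have "\<dots> = p k * ln (F k)" using F_eq[of k] by simp
    also have "\<dots> \<le> p k * ln (exp (Z k))"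
      using bound[of k] pos p_nonneg[of k]
      by (intro mult_left_mono ln_mono) (simp_all add: F_def Z_def)
    finally show ?thesis by simp
  qed
  have telescope: "\<phi> (F (int n)) - \<phi> (F (- int n)) \<le> (\<Sum>k\<in>{- int n<..int n}. p k * Z k)" for n
  proof (induction n)
    case (Suc n)
    have "{- int (Suc n)<..int (Suc n)} =
        insert (int n + 1) (insert (- int n) {- int n<..int n})"
      by auto
    then have sum_eq: "(\<Sum>k\<in>{- int (Suc n)<..int (Suc n)}. p k * Z k) =
        p (int n + 1) * Z (int n + 1) +
        (p (- int n) * Z (- int n) + (\<Sum>k\<in>{- int n<..int n}. p k * Z k))"
      by simp
    have ends: "int (Suc n) = int n + 1" "- (int n + 1) = - int n - 1" by simp_all
    have "\<phi> (F (int n + 1)) - \<phi> (F (int n)) \<le> p (int n + 1) * Z (int n + 1)"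
      using increment[of "int n + 1"] by (simp only: add_diff_cancel_right')
    with Suc.IH increment[of "- int n"] show ?case
      unfolding sum_eq unfolding ends by linarith
  qed simp
  have window: "\<phi> (F (int n)) \<le> (\<integral>\<omega>. Z (X \<omega>) * indicator {- int n<..int n} (X \<omega>) \<partial>M)" for n
  proof -
    have "\<phi> (F (- int n)) \<le> 0"
    proof (cases "F (- int n) = 0")
      case False
      then have "ln (F (- int n)) \<le> 0"
        using F_nonneg[of "- int n"] F_le_1[of "- int n"] by simp
      then show ?thesis
        unfolding \<phi>_def using F_nonneg[of "- int n"]
        by (smt (verit) mult_nonneg_nonpos)
    qed (simp add: \<phi>_def)
    with telescope[of n] have "\<phi> (F (int n)) \<le> (\<Sum>k\<in>{- int n<..int n}. p k * Z k)" by simp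
    also have "\<dots> = (\<Sum>k\<in>{- int n<..int n}.
        \<integral>\<omega>. Z k * indicator {\<omega> \<in> space M. X \<omega> = k} \<omega> \<partial>M)"
      by (simp add: p_def prob_mass_def mult.commute)
    also have "\<dots> = (\<integral>\<omega>. (\<Sum>k\<in>{- int n<..int n}.
        Z k * indicator {\<omega> \<in> space M. X \<omega> = k} \<omega>) \<partial>M)"
      by (rule Bochner_Integration.integral_sum[symmetric]) (simp add: emeasure_eq_measure)
    also have "\<dots> = (\<integral>\<omega>. Z (X \<omega>) * indicator {- int n<..int n} (X \<omega>) \<partial>M)"
    proof (rule Bochner_Integration.integral_cong)
      fix \<omega> assume "\<omega> \<in> space M"
      then have "(\<Sum>k\<in>{- int n<..int n}. Z k * indicator {\<omega> \<in> space M. X \<omega> = k} \<omega>) =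
          (\<Sum>k\<in>{- int n<..int n}. if X \<omega> = k then Z k else 0)"
        by (intro sum.cong) (auto simp: indicator_def)
      also have "\<dots> = Z (X \<omega>) * indicator {- int n<..int n} (X \<omega>)"
        by (simp add: indicator_def)
      finally show "(\<Sum>k\<in>{- int n<..int n}. Z k * indicator {\<omega> \<in> space M. X \<omega> = k} \<omega>) =
          Z (X \<omega>) * indicator {- int n<..int n} (X \<omega>)" .
    qed simp
    finally show ?thesis .
  qed
  have intZ: "integrable M (\<lambda>\<omega>. Z (X \<omega>))"
    unfolding Z_def using int by simp
  have "(\<lambda>n. \<integral>\<omega>. Z (X \<omega>) * indicator {- int n<..int n} (X \<omega>) \<partial>M) \<longlonglongrightarrow> (\<integral>\<omega>. Z (X \<omega>) \<partial>M)"
  proof (rule integral_dominated_convergence[where w = "\<lambda>\<omega>. \<bar>Z (X \<omega>)\<bar>"])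
    show "AE \<omega> in M. (\<lambda>n. Z (X \<omega>) * indicator {- int n<..int n} (X \<omega>)) \<longlonglongrightarrow> Z (X \<omega>)"
    proof (rule AE_I2, rule tendsto_eventually)
      fix \<omega>
      show "\<forall>\<^sub>F n in sequentially. Z (X \<omega>) * indicator {- int n<..int n} (X \<omega>) = Z (X \<omega>)"
        using eventually_gt_at_top[of "nat \<bar>X \<omega>\<bar>"]
        by eventually_elim (auto simp: indicator_def)
    qed
  qed (use intZ in \<open>auto simp: indicator_def intro!: AE_I2\<close>)
  moreover have "(\<lambda>n. \<phi> (F (int n))) \<longlonglongrightarrow> \<phi> 1"
    unfolding \<phi>_def F_def using prob_le_tendsto_1[OF X]
    by (intro tendsto_intros) simp_all
  ultimately have "\<phi> 1 \<le> (\<integral>\<omega>. Z (X \<omega>) \<partial>M)"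
    using window by (intro LIMSEQ_le) auto
  also have "(\<integral>\<omega>. Z (X \<omega>) \<partial>M) = a * (\<integral>\<omega>. real_of_int (X \<omega>) \<partial>M) + c"
    unfolding Z_def using int by (simp add: prob_space)
  finally show ?thesis by (simp add: \<phi>_def)
qed

text \<open>
  The supporting line of \<open>ln F\<close> is taken at the rounded mean, so \<open>F\<close> has to be positive there:
  otherwise \<open>X\<close> would almost surely exceed its mean by a fixed amount.
\<close>

lemma prob_le_ceiling_expectation_pos:
  fixes X :: "'a \<Rightarrow> int"
  assumes X [measurable]: "X \<in> measurable M (count_space UNIV)"
    and int: "integrable M (\<lambda>\<omega>. real_of_int (X \<omega>))"
  shows "\<P>(\<omega> in M. X \<omega> \<le> \<lceil>\<integral>\<omega>. real_of_int (X \<omega>) \<partial>M\<rceil>) > 0"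
proof (rule ccontr)
  let ?m = "\<lceil>\<integral>\<omega>. real_of_int (X \<omega>) \<partial>M\<rceil>"
  assume "\<not> ?thesis"
  then have "\<P>(\<omega> in M. X \<omega> \<le> ?m) = 0"
    using measure_nonneg[of M] by (simp only: not_less order_antisym)
  then have "AE \<omega> in M. \<not> X \<omega> \<le> ?m"
    by (subst (asm) prob_eq_0) simp_all
  then have "AE \<omega> in M. real_of_int (?m + 1) \<le> real_of_int (X \<omega>)"
    by eventually_elim linarith
  then have "real_of_int (?m + 1) \<le> (\<integral>\<omega>. real_of_int (X \<omega>) \<partial>M)"
    using int by (intro integral_ge_const)
  then show False by linarith
qed

end

section \<open>The lower bound at the mean\<close>

theorem theorem1p1:
  fixes M :: "'a measure" and X :: "'a \<Rightarrow> int"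
  assumes "prob_space M"
    and "X \<in> measurable M (count_space UNIV)"
    and "discrete_log_concave M X"
  shows "\<P>(\<omega> in M. real_of_int (X \<omega>) < (\<integral>\<omega>. real_of_int (X \<omega>) \<partial>M) + 1) \<ge> exp (-1)"
proof -
  interpret prob_space M by fact
  note X [measurable] = assms(2)
  note lc = assms(3)
  define \<mu> where "\<mu> = (\<integral>\<omega>. real_of_int (X \<omega>) \<partial>M)"
  define m where "m = \<lceil>\<mu>\<rceil>"
  define F where "F k = \<P>(\<omega> in M. X \<omega> \<le> k)" for k
  define a where "a = ln (F (m + 1) / F m)"
  have int: "integrable M (\<lambda>\<omega>. real_of_int (X \<omega>))"
    by (rule integrable_discrete_log_concave[OF X lc])
  have pos: "F m > 0"
    using prob_le_ceiling_expectation_pos[OF X int] by (simp add: F_def m_def \<mu>_def)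
  have "F m \<le> F (m + 1)"
    using prob_le_mono[OF X, of m "m + 1"] by (simp add: F_def)
  with pos have a: "a \<ge> 0" by (simp add: a_def)
  have "F k \<le> exp (a * real_of_int k + (ln (F m) - a * real_of_int m))" for k
  proof -
    have "F k \<le> F m * exp (a * (real_of_int k - real_of_int m))"
      unfolding a_def F_def using pos by (intro cdf_le_exponential X lc) (simp add: F_def)
    also have "\<dots> = exp (ln (F m) + a * (real_of_int k - real_of_int m))"
      using pos by (simp add: exp_add)
    finally show ?thesis by (simp add: algebra_simps)
  qed
  then have "- 1 \<le> a * \<mu> + (ln (F m) - a * real_of_int m)"
    unfolding \<mu>_def F_def by (rule expectation_ge_of_exponential_cdf_bound[OF X int])
  also have "\<dots> \<le> ln (F m)"
    using mult_left_mono[OF _ a, of \<mu> "real_of_int m"] by (simp add: m_def)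
  finally have "exp (- 1) \<le> F m"
    using pos by (simp add: ln_ge_iff)
  also have "F m \<le> \<P>(\<omega> in M. real_of_int (X \<omega>) < \<mu> + 1)"
    unfolding F_def
  proof (intro finite_measure_mono subsetI)
    fix \<omega> assume "\<omega> \<in> {\<omega> \<in> space M. X \<omega> \<le> m}"
    then show "\<omega> \<in> {\<omega> \<in> space M. real_of_int (X \<omega>) < \<mu> + 1}"
      unfolding m_def by (auto simp: le_ceiling_iff)
  qed simp
  finally show ?thesis by (simp add: \<mu>_def)
qed

end
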